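(* Let $\beta,\gamma>0$ with $\gamma\neq\beta$, and let $\alpha=\beta$, $\delta=\gamma$ (the deltoid II). Consider the configurations $(x,y,z,w)\in(\mathbb{R}\cup\{\infty\})^4$ of the planar 4-bar linkage with bar lengths $\alpha,\beta,\gamma,\delta$. (1) The configurations with $x\neq\infty$ are exactly the quadruples of real numbers $(x,y,z,w)$ of one of the two forms $$y=w=\frac{\gamma x+\sqrt{\gamma^2(x^2+1)-\beta^2}}{\beta-\gamma},\quad z=-\frac{\sqrt{\gamma^2(x^2+1)-\beta^2}}{\beta},$$ or $$y=w=\frac{\gamma x-\sqrt{\gamma^2(x^2+1)-\beta^2}}{\beta-\gamma},\quad z=\frac{\sqrt{\gamma^2(x^2+1)-\beta^2}}{\beta},$$ where $x\in\left(-\infty,-\sqrt{\frac{\beta^2}{\gamma^2}-1}\,\right]\cup\left[\sqrt{\frac{\beta^2}{\gamma^2}-1},+\infty\right)$ if $\beta>\gamma$, and $x\in\mathbb{R}$ if $\beta<\gamma$. (2) The configurations in which at least one of $x,y,z,w$ equals $\infty$ form the branch $\{(\infty,\,y,\,\infty,\,-y) : y\in\mathbb{R}\cup\{\infty\}\}$, which is diffeomorphic to a circle $S^1$.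
   Context: $\mathbb{R}\cup\{\infty\}$ is the one-point compactification of $\mathbb{R}$, with $-\infty=\infty$. A planar 4-bar linkage has bar lengths $\alpha,\beta,\gamma,\delta>0$ in counter-clockwise cyclic order. Its configurations are described by rotational angles $\rho_x,\rho_y,\rho_z,\rho_w\in\mathbb{R}/2\pi\mathbb{Z}$, the (exterior) turning angles from bar $\alpha$ to $\beta$, from $\beta$ to $\gamma$, from $\gamma$ to $\delta$, and from $\delta$ to $\alpha$, respectively, when the closed quadrilateral is traversed once. Thus a quadruple of angles is a configuration if and only if $\rho_x+\rho_y+\rho_z+\rho_w\equiv 0 \pmod{2\pi}$ and $\beta+\gamma e^{i\rho_y}+\delta e^{i(\rho_y+\rho_z)}+\alpha e^{i(\rho_y+\rho_z+\rho_w)}=0$ (self-intersections and overlaps of bars are allowed). One writes $x=\tan\frac{\rho_x}{2}$, $y=\tan\frac{\rho_y}{2}$, $z=\tan\frac{\rho_z}{2}$, $w=\tan\frac{\rho_w}{2}$, with value $\infty$ when the angle is $\pi$, and identifies a configuration with $(x,y,z,w)\in(\mathbb{R}\cup\{\infty\})^4$. *)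

theory Defs
  imports "HOL-Analysis.Analysis" "HOL-Library.Real_Mod"
begin

section \<open>Smooth maps and diffeomorphic subsets\<close>

text \<open>The set \<open>S\<close> is meant to be open in the next two definitions.\<close>

primrec C_times_diff_on ::
  "nat \<Rightarrow> 'a::real_normed_vector set \<Rightarrow> ('a \<Rightarrow> 'b::real_normed_vector) \<Rightarrow> bool" where
  "C_times_diff_on 0 S f \<longleftrightarrow> continuous_on S f"
| "C_times_diff_on (Suc n) S f \<longleftrightarrow>
     (\<forall>x\<in>S. f differentiable (at x)) \<and>
     (\<forall>v. C_times_diff_on n S (\<lambda>x. frechet_derivative f (at x) v))"

definition smooth_on ::
  "'a::real_normed_vector set \<Rightarrow> ('a \<Rightarrow> 'b::real_normed_vector) \<Rightarrow> bool" where
  "smooth_on S f \<longleftrightarrow> (\<forall>n. C_times_diff_on n S f)"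

text \<open>
  A chart is a domain together with a map that is injective on the domain and has an open
  image in a Euclidean space. A manifold is presented by an atlas, i.e. a set of charts.
\<close>

type_synonym ('a, 'e) chart = "'a set \<times> ('a \<Rightarrow> 'e)"

definition prod_atlas ::
  "('a, 'e) chart set \<Rightarrow> ('b, 'f) chart set \<Rightarrow> ('a \<times> 'b, 'e \<times> 'f) chart set" where
  "prod_atlas A B = {(U \<times> V, map_prod \<phi> \<psi>) | U \<phi> V \<psi>. (U, \<phi>) \<in> A \<and> (V, \<psi>) \<in> B}"

definition euclidean_atlas :: "('e, 'e) chart set" where
  "euclidean_atlas = {(UNIV, \<lambda>x. x)}"

text \<open>
  Smoothness of a map between arbitrary subsets of manifolds, in the usual sense: near each
  point of \<open>S\<close> the map is the restriction of a smooth map defined on an open set of the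
  ambient manifold. A subset diffeomorphic to a manifold in this sense is automatically an
  embedded submanifold, and the diffeomorphism is one for the submanifold structure.
\<close>

definition smooth_map_on ::
  "('a, 'e::euclidean_space) chart set \<Rightarrow> 'a set \<Rightarrow> ('b, 'f::euclidean_space) chart set \<Rightarrow>
   ('a \<Rightarrow> 'b) \<Rightarrow> bool" where
  "smooth_map_on A S B f \<longleftrightarrow>
     (\<forall>p\<in>S. \<exists>U \<phi> V \<psi>. (U, \<phi>) \<in> A \<and> p \<in> U \<and> (V, \<psi>) \<in> B \<and> f p \<in> V \<and>
        (\<exists>W g. open W \<and> \<phi> p \<in> W \<and> W \<subseteq> \<phi> ` U \<and> smooth_on W g \<and>
           (\<forall>q\<in>S \<inter> U. \<phi> q \<in> W \<longrightarrow> f q \<in> V \<and> \<psi> (f q) = g (\<phi> q))))"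

definition diffeomorphic ::
  "('a, 'e::euclidean_space) chart set \<Rightarrow> 'a set \<Rightarrow>
   ('b, 'f::euclidean_space) chart set \<Rightarrow> 'b set \<Rightarrow> bool" where
  "diffeomorphic A S B T \<longleftrightarrow>
     (\<exists>f g. smooth_map_on A S B f \<and> smooth_map_on B T A g \<and>
        f ` S = T \<and> g ` T = S \<and> (\<forall>p\<in>S. g (f p) = p) \<and> (\<forall>q\<in>T. f (g q) = q))"


section \<open>The one-point compactification of the real line\<close>

text \<open>
  As in the library's Alexandroff compactification, \<open>real option\<close> is the line with the
  point \<open>None\<close> added at infinity.
\<close>

type_synonym real_infty = "real option"

abbreviation Infty :: real_infty where
  "Infty \<equiv> None"

definition neg1 :: "real_infty \<Rightarrow> real_infty" where
  "neg1 = map_option uminus"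

text \<open>
  The standard smooth structure of the real projective line: the coordinate \<open>x\<close> away
  from infinity and the coordinate \<open>1/x\<close> away from zero. The lemmas below confirm that its
  transition maps are smooth and that it induces the topology of the one-point compactification.
\<close>

definition recip_coord :: "real_infty \<Rightarrow> real" where
  "recip_coord p = (case p of None \<Rightarrow> 0 | Some x \<Rightarrow> 1 / x)"

definition line_atlas :: "(real_infty, real) chart set" where
  "line_atlas = {(UNIV - {Infty}, the), (UNIV - {Some 0}, recip_coord)}"

definition line_atlas4 ::
  "(real_infty \<times> real_infty \<times> real_infty \<times> real_infty, real \<times> real \<times> real \<times> real) chart set" where
  "line_atlas4 =
     prod_atlas line_atlas (prod_atlas line_atlas (prod_atlas line_atlas line_atlas))"

lemma inj_on_line_chart: "(U, \<phi>) \<in> line_atlas \<Longrightarrow> inj_on \<phi> U"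
  by (auto simp: line_atlas_def inj_on_def recip_coord_def split: option.splits)

lemma the_image: "the ` (V - {None}) = {x. Some x \<in> V}"
  by (auto simp: image_iff) (metis DiffI option.sel option.distinct(1) singletonD)

lemma recip_coord_image:
  "recip_coord ` (V - {Some 0}) = {t. if t = 0 then None \<in> V else Some (1 / t) \<in> V}"
proof (intro set_eqI iffI)
  fix t assume "t \<in> recip_coord ` (V - {Some 0})"
  then obtain p where "p \<in> V" "p \<noteq> Some 0" "t = recip_coord p" by auto
  then show "t \<in> {t. if t = 0 then None \<in> V else Some (1 / t) \<in> V}"
    by (cases p) (auto simp: recip_coord_def)
next
  fix t assume t: "t \<in> {t. if t = 0 then None \<in> V else Some (1 / t) \<in> V}"
  show "t \<in> recip_coord ` (V - {Some 0})"
  proof (cases "t = 0")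
    case True
    then have "None \<in> V - {Some 0}" "t = recip_coord None"
      using t by (auto simp: recip_coord_def)
    then show ?thesis by blast
  next
    case False
    then have "Some (1 / t) \<in> V - {Some 0}" "t = recip_coord (Some (1 / t))"
      using t by (auto simp: recip_coord_def)
    then show ?thesis by blast
  qed
qed

lemma C_times_diff_on_cong:
  assumes "open S" "\<And>x. x \<in> S \<Longrightarrow> f x = g x"
  shows "C_times_diff_on n S f \<longleftrightarrow> C_times_diff_on n S g"
proof -
  have *: "C_times_diff_on n S g" if "C_times_diff_on n S f" "\<And>x. x \<in> S \<Longrightarrow> f x = g x" for f g
    using that
  proof (induction n arbitrary: f g)
    case 0
    then show ?case using continuous_on_cong[of S S f g] by simp
  next
    case (Suc n)
    have d: "(g has_derivative frechet_derivative f (at x)) (at x)" if "x \<in> S" for x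
    proof (rule has_derivative_transform_within_open[OF _ assms(1) that])
      show "(f has_derivative frechet_derivative f (at x)) (at x)"
        using Suc.prems(1) that by (simp add: frechet_derivative_works[symmetric])
    qed (use Suc.prems(2) in auto)
    have "frechet_derivative f (at x) v = frechet_derivative g (at x) v" if "x \<in> S" for x v
      using frechet_derivative_at[OF d[OF that]] by simp
    then have "C_times_diff_on n S (\<lambda>x. frechet_derivative g (at x) v)" for v
      using Suc.IH[of "\<lambda>x. frechet_derivative f (at x) v"] Suc.prems(1) by simp
    then show ?case using d by (auto simp: differentiable_def)
  qed
  show ?thesis using *[of f g] *[of g f] assms(2) by auto
qed

lemma smooth_on_inverse_real: "smooth_on (- {0::real}) (\<lambda>x. 1 / x)"
proof -
  have *: "C_times_diff_on n (- {0::real}) (\<lambda>x. c * inverse x ^ k)" for n c k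
  proof (induction n arbitrary: c k)
    case 0
    show ?case by (auto intro!: continuous_intros)
  next
    case (Suc n)
    have d: "((\<lambda>x. c * inverse x ^ k) has_derivative
        (\<lambda>v. (- c * real k * v) * inverse x ^ Suc k)) (at x)" if "x \<noteq> 0" for x
    proof -
      have "((\<lambda>x. c * inverse x ^ k) has_real_derivative
          - c * real k * inverse x ^ Suc k) (at x)"
        using DERIV_cmult[OF DERIV_power[OF DERIV_inverse[OF that], of k], of c]
        by (cases k) (simp_all add: mult_ac)
      then show ?thesis
        by (rule has_derivative_eq_rhs[OF has_field_derivative_imp_has_derivative])
           (auto simp: fun_eq_iff)
    qed
    have "C_times_diff_on n (- {0}) (\<lambda>x. frechet_derivative (\<lambda>x. c * inverse x ^ k) (at x) v)" for v
      using Suc.IH[of "- c * real k * v" "Suc k"] frechet_derivative_at[OF d, symmetric]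
      by (subst C_times_diff_on_cong) auto
    then show ?case using d by (auto simp: differentiable_def)
  qed
  show ?thesis using *[of _ 1 1] by (simp add: smooth_on_def inverse_eq_divide)
qed

lemma smooth_on_ident_real: "smooth_on S (\<lambda>x::real. x)"
proof -
  have c: "C_times_diff_on n S (\<lambda>x::real. c::real)" for n c
    by (induction n arbitrary: c) simp_all
  have "C_times_diff_on n S (\<lambda>x::real. x)" for n
    by (cases n) (simp_all add: c)
  then show ?thesis by (simp add: smooth_on_def)
qed

lemma smooth_line_transition:
  assumes "(U, \<phi>) \<in> line_atlas" "(V, \<psi>) \<in> line_atlas"
  shows "smooth_on (\<phi> ` (U \<inter> V)) (\<psi> \<circ> inv_into U \<phi>)"
proof -
  have cong: "smooth_on S f" if "open S" "smooth_on S g" "\<And>x. x \<in> S \<Longrightarrow> f x = g x"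
    for S and f g :: "real \<Rightarrow> real"
    using that C_times_diff_on_cong[of S f g] by (simp add: smooth_on_def)
  have img: "\<phi> ` (U \<inter> V) = (if U = V then UNIV else - {0})"
  proof -
    have "the ` (UNIV - {None}) = (UNIV :: real set)"
      "recip_coord ` (UNIV - {Some 0}) = UNIV"
      unfolding the_image recip_coord_image by auto
    moreover have "the ` ((UNIV - {None}) \<inter> (UNIV - {Some 0})) = - {0::real}"
    proof -
      have e: "(UNIV - {None}) \<inter> (UNIV - {Some 0}) = (UNIV - {Some (0::real)}) - {None}" by auto
      show ?thesis unfolding e the_image by auto
    qed
    moreover have "recip_coord ` ((UNIV - {Some 0}) \<inter> (UNIV - {None})) = - {0}"
    proof -
      have e: "(UNIV - {Some 0}) \<inter> (UNIV - {None}) = (UNIV - {None}) - {Some (0::real)}" by auto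
      show ?thesis unfolding e recip_coord_image by auto
    qed
    moreover have "UNIV - {None} \<noteq> UNIV - {Some (0::real)}" by blast
    ultimately show ?thesis
      using assms unfolding line_atlas_def by (elim insertE emptyE) simp_all
  qed
  have eq: "\<phi> = \<psi>" if "U = V"
    using assms that unfolding line_atlas_def by auto
  have inv: "(\<psi> \<circ> inv_into U \<phi>) (\<phi> p) = \<psi> p" if "p \<in> U" for p
    using that inj_on_line_chart[OF assms(1)] by simp
  show ?thesis
  proof (cases "U = V")
    case True
    have "(\<psi> \<circ> inv_into U \<phi>) t = t" for t
    proof -
      have "t \<in> \<phi> ` U" using img True by simp
      then show ?thesis using inv eq[OF True] by (auto simp: f_inv_into_f)
    qed
    then show ?thesis unfolding img using True cong[OF _ smooth_on_ident_real] by simp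
  next
    case False
    have "(\<psi> \<circ> inv_into U \<phi>) t = 1 / t" if "t \<in> - {0}" for t
    proof -
      have "t \<in> \<phi> ` (U \<inter> V)" using that False by (simp add: img)
      then obtain p where p: "p \<in> U \<inter> V" "t = \<phi> p" by (rule imageE)
      then have "\<psi> p = 1 / \<phi> p"
        using assms False unfolding line_atlas_def
        by (cases p) (auto simp: recip_coord_def)
      then show ?thesis using inv p by simp
    qed
    then have "smooth_on (- {0}) (\<psi> \<circ> inv_into U \<phi>)"
      by (intro cong[OF _ smooth_on_inverse_real]) auto
    then show ?thesis using False by (simp add: img)
  qed
qed

lemma openin_Alexandroff_compactification_real_iff:
  "openin (Alexandroff_compactification euclideanreal) V \<longleftrightarrow>
     (\<forall>(U, \<phi>) \<in> line_atlas. open (\<phi> ` (V \<inter> U)))"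
proof -
  define X where "X = {x::real. Some x \<in> V}"
  define Y where "Y = {t::real. if t = 0 then None \<in> V else Some (1 / t) \<in> V}"
  have rhs: "(\<forall>(U, \<phi>) \<in> line_atlas. open (\<phi> ` (V \<inter> U))) \<longleftrightarrow> open X \<and> open Y"
    unfolding line_atlas_def X_def Y_def the_image[symmetric] recip_coord_image[symmetric]
    by (simp add: Diff_eq)
  have open_Y0: "open (Y - {0})" if "open X"
  proof -
    have "Y - {0} = (\<lambda>t. 1 / t) -` X \<inter> (- {0})"
      by (auto simp: X_def Y_def)
    moreover have "open ((\<lambda>t::real. 1 / t) -` X \<inter> (- {0}))"
    proof -
      have "continuous_on (- {0}) (\<lambda>t::real. 1 / t)"
        by (auto intro!: continuous_intros)
      then have "open (- {0} \<inter> (\<lambda>t::real. 1 / t) -` X)"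
        by (rule continuous_open_preimage) (auto intro: that)
      then show ?thesis by (simp add: Int_commute)
    qed
    ultimately show ?thesis by simp
  qed
  have open_Y: "open Y" if "open X" "None \<in> V \<Longrightarrow> bounded (- X)"
  proof (cases "None \<in> V")
    case False
    then have "Y = Y - {0}" by (auto simp: Y_def)
    then show ?thesis using open_Y0[OF that(1)] by simp
  next
    case True
    with that(2) obtain B where B: "B > 0" "\<And>x. x \<in> - X \<Longrightarrow> \<bar>x\<bar> \<le> B"
      by (metis bounded_pos real_norm_def)
    have "ball 0 (1 / B) \<subseteq> Y"
    proof
      fix t assume "t \<in> ball (0::real) (1 / B)"
      then have t: "\<bar>t\<bar> < 1 / B" by simp
      show "t \<in> Y"
      proof (cases "t = 0")
        case False
        then have "\<bar>1 / t\<bar> > B" using t B(1) by (simp add: field_simps)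
        then have "1 / t \<in> X" using B(2)[of "1 / t"] by force
        then show ?thesis using False by (simp add: X_def Y_def)
      qed (use True in \<open>simp add: Y_def\<close>)
    qed
    moreover have "0 \<in> ball (0::real) (1 / B)" using B(1) by simp
    ultimately have "Y = (Y - {0}) \<union> ball 0 (1 / B)" by blast
    then show ?thesis using open_Y0[OF that(1)] by (metis open_Un open_ball)
  qed
  have bounded_X: "bounded (- X)" if "open Y" "None \<in> V"
  proof -
    have "0 \<in> Y" using that(2) by (simp add: Y_def)
    then obtain e where e: "e > 0" "ball 0 e \<subseteq> Y"
      using \<open>open Y\<close> by (meson open_contains_ball)
    have "\<bar>x\<bar> \<le> 1 / e" if "x \<in> - X" for x
    proof (rule ccontr)
      assume "\<not> \<bar>x\<bar> \<le> 1 / e"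
      then have x: "\<bar>x\<bar> > 1 / e" by simp
      moreover have "1 / e > 0" using e(1) by simp
      ultimately have "\<bar>x\<bar> > 0" by linarith
      then have "x \<noteq> 0" by simp
      have "1 < \<bar>x\<bar> * e" using x e(1) by (simp add: pos_divide_less_eq)
      then have "1 / \<bar>x\<bar> < e"
        using \<open>\<bar>x\<bar> > 0\<close> by (simp add: pos_divide_less_eq mult.commute)
      then have "1 / x \<in> ball 0 e" by simp
      then have "1 / x \<in> Y" using e(2) by blast
      then show False using \<open>x \<noteq> 0\<close> that by (simp add: Y_def X_def)
    qed
    then show ?thesis by (auto simp: bounded_real)
  qed
  have lhs: "openin (Alexandroff_compactification euclideanreal) V \<longleftrightarrow>
      open X \<and> (None \<in> V \<longrightarrow> bounded (- X))"
  proof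
    assume "openin (Alexandroff_compactification euclideanreal) V"
    then consider U where "open U" "V = Some ` U"
      | C where "compact C" "V = insert None (Some ` (- C))"
      by (auto simp: openin_Alexandroff_compactification Compl_eq_Diff_UNIV)
    then show "open X \<and> (None \<in> V \<longrightarrow> bounded (- X))"
    proof cases
      case 1
      then have "X = U" by (auto simp: X_def)
      with 1 show ?thesis by auto
    next
      case 2
      then have "X = - C" by (auto simp: X_def)
      with 2 show ?thesis by (auto simp: compact_eq_bounded_closed)
    qed
  next
    assume R: "open X \<and> (None \<in> V \<longrightarrow> bounded (- X))"
    show "openin (Alexandroff_compactification euclideanreal) V"
    proof (cases "None \<in> V")
      case False
      then have "V = Some ` X"
        by (auto simp: X_def image_iff) (metis not_None_eq)
      then show ?thesis using R by simp
    next
      case True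
      then have "V = insert None (Some ` (topspace euclideanreal - (- X)))"
        by (auto simp: X_def image_iff) (metis not_None_eq)
      moreover have "compact (- X)" using R True
        by (simp add: compact_eq_bounded_closed closed_def)
      ultimately show ?thesis using R
        by (subst openin_Alexandroff_compactification) (auto simp: closed_Compl)
    qed
  qed
  show ?thesis
    unfolding rhs lhs using open_Y bounded_X by blast
qed


section \<open>Configurations of a planar 4-bar linkage\<close>

definition half_tan :: "real \<Rightarrow> real_infty" where
  "half_tan \<rho> = (if [\<rho> = pi] (rmod 2 * pi) then Infty else Some (tan (\<rho> / 2)))"

text \<open>Elements of \<open>\<real>/2\<pi>\<int>\<close> are given by real representatives.\<close>

definition linkage_angles ::
  "real \<Rightarrow> real \<Rightarrow> real \<Rightarrow> real \<Rightarrow> real \<Rightarrow> real \<Rightarrow> real \<Rightarrow> real \<Rightarrow> bool" where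
  "linkage_angles \<alpha> \<beta> \<gamma> \<delta> \<rho>x \<rho>y \<rho>z \<rho>w \<longleftrightarrow>
     [\<rho>x + \<rho>y + \<rho>z + \<rho>w = 0] (rmod 2 * pi) \<and>
     of_real \<beta> + of_real \<gamma> * exp (\<i> * of_real \<rho>y)
       + of_real \<delta> * exp (\<i> * of_real (\<rho>y + \<rho>z))
       + of_real \<alpha> * exp (\<i> * of_real (\<rho>y + \<rho>z + \<rho>w)) = 0"

definition linkage_configs ::
  "real \<Rightarrow> real \<Rightarrow> real \<Rightarrow> real \<Rightarrow> (real_infty \<times> real_infty \<times> real_infty \<times> real_infty) set" where
  "linkage_configs \<alpha> \<beta> \<gamma> \<delta> =
     {(half_tan \<rho>x, half_tan \<rho>y, half_tan \<rho>z, half_tan \<rho>w) | \<rho>x \<rho>y \<rho>z \<rho>w.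
        linkage_angles \<alpha> \<beta> \<gamma> \<delta> \<rho>x \<rho>y \<rho>z \<rho>w}"

end

theory Submission
  imports Defs
begin

text \<open>
  Write \<open>X, Y, Z, W\<close> for the unit complex numbers \<open>exp (i \<rho>)\<close> of the four angles; they are the
  Cayley transforms of \<open>x, y, z, w\<close>. For the deltoid the closing conditions become
  \<open>X Y Z W = 1\<close> and \<open>\<beta> (1 + X) + \<gamma> X Y (1 + Z) = 0\<close>. If \<open>X = -1\<close>, they say \<open>Z = -1\<close> and
  \<open>Y W = 1\<close>, which is the branch at infinity. If \<open>X \<noteq> -1\<close>, then comparing the second condition
  with its complex conjugate shows that the first one amounts to \<open>Y = W\<close>; all coordinates are
  finite because \<open>\<beta> \<noteq> \<gamma>\<close>, and the real and imaginary parts of the second condition give the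
  two formulas. On the branch at infinity, the Cayley transform of \<open>y\<close> is the diffeomorphism
  onto the circle.
\<close>

section \<open>Closure properties of smooth maps\<close>

text \<open>The recursion refers to \<open>frechet_derivative\<close>, which is defined by choice.
  Derivatives are unique and \<open>S\<close> is open, so any explicit derivative may replace it.
  The closure proofs below therefore only need the usual differentiation rules.\<close>

lemma C_times_diff_on_SucI:
  assumes "open S" "\<And>x. x \<in> S \<Longrightarrow> (f has_derivative f' x) (at x)"
    "\<And>v. C_times_diff_on n S (\<lambda>x. f' x v)"
  shows "C_times_diff_on (Suc n) S f"
proof -
  have "frechet_derivative f (at x) v = f' x v" if "x \<in> S" for x v
    using frechet_derivative_at[OF assms(2)[OF that]] by simp
  then have "C_times_diff_on n S (\<lambda>x. frechet_derivative f (at x) v)" for v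
    by (rule iffD2[OF C_times_diff_on_cong[OF assms(1)] assms(3)])
  then show ?thesis using assms(2) by (auto simp: differentiable_def)
qed

lemma C_times_diff_on_has_derivative:
  assumes "C_times_diff_on (Suc n) S f" "x \<in> S"
  shows "(f has_derivative frechet_derivative f (at x)) (at x)"
  using assms by (simp add: frechet_derivative_works[symmetric])

text \<open>Order \<open>Suc n\<close> does not contain order \<open>n\<close> by definition. The
  descent passes to the derivatives until differentiability gives continuity.\<close>

lemma C_times_diff_on_SucD: "C_times_diff_on (Suc n) S f \<Longrightarrow> C_times_diff_on n S f"
proof (induction n arbitrary: f)
  case 0
  then show ?case
    by (auto intro!: continuous_at_imp_continuous_on differentiable_imp_continuous_within)
next
  case (Suc n)
  then show ?case by simp
qed

lemma C_times_diff_on_const: "C_times_diff_on n S (\<lambda>x. c)"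
  by (induction n arbitrary: c) simp_all

lemma C_times_diff_on_bounded_linear:
  assumes "open S" "bounded_linear h" "C_times_diff_on n S f"
  shows "C_times_diff_on n S (\<lambda>x. h (f x))"
  using assms(3)
proof (induction n arbitrary: f)
  case 0
  then show ?case using assms(2) by (simp add: bounded_linear.continuous_on)
next
  case (Suc n)
  show ?case
  proof (rule C_times_diff_on_SucI[OF assms(1)])
    show "((\<lambda>x. h (f x)) has_derivative (\<lambda>v. h (frechet_derivative f (at x) v))) (at x)"
      if "x \<in> S" for x
      using C_times_diff_on_has_derivative[OF Suc.prems that]
      by (rule bounded_linear.has_derivative[OF assms(2)])
  qed (use Suc in auto)
qed

lemma C_times_diff_on_add:
  assumes "open S" "C_times_diff_on n S f" "C_times_diff_on n S g"
  shows "C_times_diff_on n S (\<lambda>x. f x + g x)"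
  using assms(2,3)
proof (induction n arbitrary: f g)
  case 0
  then show ?case by (auto intro: continuous_on_add)
next
  case (Suc n)
  show ?case
  proof (rule C_times_diff_on_SucI[OF assms(1) has_derivative_add])
    show "(f has_derivative frechet_derivative f (at x)) (at x)" if "x \<in> S" for x
      using C_times_diff_on_has_derivative[OF Suc.prems(1) that] .
    show "(g has_derivative frechet_derivative g (at x)) (at x)" if "x \<in> S" for x
      using C_times_diff_on_has_derivative[OF Suc.prems(2) that] .
    show "C_times_diff_on n S (\<lambda>x. frechet_derivative f (at x) v + frechet_derivative g (at x) v)" for v
      using Suc by auto
  qed
qed

lemma C_times_diff_on_mult:
  fixes f g :: "'a::real_normed_vector \<Rightarrow> 'b::real_normed_algebra"
  assumes "open S" "C_times_diff_on n S f" "C_times_diff_on n S g"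
  shows "C_times_diff_on n S (\<lambda>x. f x * g x)"
  using assms(2,3)
proof (induction n arbitrary: f g)
  case 0
  then show ?case by (auto intro: continuous_on_mult)
next
  case (Suc n)
  show ?case
  proof (rule C_times_diff_on_SucI[OF assms(1) has_derivative_mult])
    show "(f has_derivative frechet_derivative f (at x)) (at x)" if "x \<in> S" for x
      using C_times_diff_on_has_derivative[OF Suc.prems(1) that] .
    show "(g has_derivative frechet_derivative g (at x)) (at x)" if "x \<in> S" for x
      using C_times_diff_on_has_derivative[OF Suc.prems(2) that] .
    show "C_times_diff_on n S (\<lambda>x. f x * frechet_derivative g (at x) v +
        frechet_derivative f (at x) v * g x)" for v
      \<comment> \<open>Each summand of the product rule pairs a derivative, of order
        \<open>n\<close>, with an undifferentiated factor, which has to be lowered to order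
        \<open>n\<close> first.\<close>
      using Suc.prems Suc.prems[THEN C_times_diff_on_SucD]
      by (intro C_times_diff_on_add[OF assms(1)] Suc.IH) simp_all
  qed
qed

text \<open>The derivative of the inverse is a product containing the inverse itself, so the
  induction hypothesis for the inverse controls its own derivative.\<close>

lemma C_times_diff_on_inverse:
  fixes f :: "'a::real_normed_vector \<Rightarrow> 'b::real_normed_div_algebra"
  assumes "open S" "\<And>x. x \<in> S \<Longrightarrow> f x \<noteq> 0" "C_times_diff_on n S f"
  shows "C_times_diff_on n S (\<lambda>x. inverse (f x))"
  using assms(3)
proof (induction n)
  case 0
  then show ?case using assms(2) by (auto intro: continuous_on_inverse)
next
  case (Suc n)
  have inv: "C_times_diff_on n S (\<lambda>x. inverse (f x))"
    using Suc by (blast dest: C_times_diff_on_SucD)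
  show ?case
  proof (rule C_times_diff_on_SucI[OF assms(1) Deriv.has_derivative_inverse])
    show "(f has_derivative frechet_derivative f (at x)) (at x)" if "x \<in> S" for x
      using C_times_diff_on_has_derivative[OF Suc.prems that] .
    show "f x \<noteq> 0" if "x \<in> S" for x
      using assms(2)[OF that] .
    show "C_times_diff_on n S
        (\<lambda>x. - (inverse (f x) * frechet_derivative f (at x) v * inverse (f x)))" for v
      using Suc.prems inv
      by (intro C_times_diff_on_bounded_linear[OF assms(1) bounded_linear_minus[OF bounded_linear_ident]]
          C_times_diff_on_mult[OF assms(1)]) auto
  qed
qed

section \<open>Closure rules for smoothness of all orders\<close>

lemma smooth_on_const: "smooth_on S (\<lambda>x. c)"
  by (simp add: smooth_on_def C_times_diff_on_const)

lemma smooth_on_bounded_linear_compose: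
  "open S \<Longrightarrow> bounded_linear h \<Longrightarrow> smooth_on S f \<Longrightarrow> smooth_on S (\<lambda>x. h (f x))"
  by (simp add: smooth_on_def C_times_diff_on_bounded_linear)

lemma smooth_on_bounded_linear:
  assumes "open S" "bounded_linear h"
  shows "smooth_on S h"
proof -
  have "C_times_diff_on n S h" for n
  proof (cases n)
    case 0
    then show ?thesis using assms(2) by (simp add: linear_continuous_on)
  next
    case (Suc m)
    then show ?thesis
      using C_times_diff_on_SucI[OF assms(1) bounded_linear_imp_has_derivative[OF assms(2)]]
        C_times_diff_on_const by blast
  qed
  then show ?thesis by (simp add: smooth_on_def)
qed

lemma smooth_on_add:
  "open S \<Longrightarrow> smooth_on S f \<Longrightarrow> smooth_on S g \<Longrightarrow> smooth_on S (\<lambda>x. f x + g x)"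
  by (simp add: smooth_on_def C_times_diff_on_add)

lemma smooth_on_mult:
  fixes f g :: "'a::real_normed_vector \<Rightarrow> 'b::real_normed_algebra"
  shows "open S \<Longrightarrow> smooth_on S f \<Longrightarrow> smooth_on S g \<Longrightarrow> smooth_on S (\<lambda>x. f x * g x)"
  by (simp add: smooth_on_def C_times_diff_on_mult)

lemma smooth_on_divide:
  fixes f g :: "'a::real_normed_vector \<Rightarrow> 'b::real_normed_field"
  shows "open S \<Longrightarrow> smooth_on S f \<Longrightarrow> smooth_on S g \<Longrightarrow> (\<And>x. x \<in> S \<Longrightarrow> g x \<noteq> 0)
    \<Longrightarrow> smooth_on S (\<lambda>x. f x / g x)"
  by (simp add: smooth_on_def divide_inverse C_times_diff_on_mult C_times_diff_on_inverse)


section \<open>The Cayley transform\<close>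

text \<open>For t = tan(r/2) the quotient is exp(i r), so conditions on angles become polynomial
  equations between points of the unit circle. The value at infinity is the limit for t tending to
  either end of the line.\<close>

definition cayley :: "real_infty \<Rightarrow> complex" where
  "cayley p = (case p of None \<Rightarrow> -1 | Some t \<Rightarrow> (1 + \<i> * t) / (1 - \<i> * t))"

lemma one_plus_minus_ii_neq_0: "1 + \<i> * complex_of_real t \<noteq> 0" "1 - \<i> * complex_of_real t \<noteq> 0"
  by (auto simp: complex_eq_iff)

lemma cayley_Infty [simp]: "cayley None = -1"
  by (simp add: cayley_def)

lemma cayley_Some: "cayley (Some t) = (1 + \<i> * t) / (1 - \<i> * t)"
  by (simp add: cayley_def)

lemma cayley_Some_neq: "cayley (Some t) \<noteq> -1"
  using one_plus_minus_ii_neq_0[of t] by (simp add: cayley_Some field_simps)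

lemma cayley_eq_minus_1_iff: "cayley p = -1 \<longleftrightarrow> p = None"
  using cayley_Some_neq by (cases p) auto

lemma inj_cayley: "inj cayley"
proof (rule injI)
  fix p q assume pq: "cayley p = cayley q"
  show "p = q"
  proof (cases "p = None \<or> q = None")
    case True
    then show ?thesis using pq by (metis cayley_eq_minus_1_iff)
  next
    case False
    then obtain a b where ab: "p = Some a" "q = Some b" by auto
    have "(1 + \<i> * a) * (1 - \<i> * b) = (1 + \<i> * b) * (1 - \<i> * a)"
      using pq unfolding ab cayley_Some
      by (rule iffD1[OF frac_eq_eq[OF one_plus_minus_ii_neq_0(2) one_plus_minus_ii_neq_0(2)]])
    then show ?thesis using ab by (auto simp: complex_eq_iff)
  qed
qed

lemma norm_cayley [simp]: "norm (cayley p) = 1"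
proof (cases p)
  case (Some t)
  have "norm (1 + \<i> * complex_of_real t) = norm (1 - \<i> * complex_of_real t)"
    by (simp add: cmod_def)
  then show ?thesis
    using Some one_plus_minus_ii_neq_0 by (simp add: cayley_Some norm_divide)
qed simp

lemma cayley_neq_0 [simp]: "cayley p \<noteq> 0"
  using norm_cayley[of p] by (metis norm_zero zero_neq_one)

lemma cnj_cayley: "cnj (cayley p) = inverse (cayley p)"
  using complex_div_cnj[of 1 "cayley p"] by (simp add: inverse_eq_divide)

lemma cayley_neg1: "cayley (neg1 p) = inverse (cayley p)"
  by (cases p) (simp_all add: neg1_def cayley_Some)

section \<open>Angles modulo 2 pi as points of the unit circle\<close>

lemma cis_eq_1_iff_rcong: "cis \<theta> = 1 \<longleftrightarrow> [\<theta> = 0] (rmod 2 * pi)"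
proof
  assume "cis \<theta> = 1"
  then have "cos \<theta> = 1" by (simp add: complex_eq_iff)
  then obtain n :: int where "\<theta> = of_int n * 2 * pi"
    unfolding cos_one_2pi_int by blast
  then show "[\<theta> = 0] (rmod 2 * pi)"
    by (simp add: mult.assoc rcong_mult_of_int_0_left_right)
next
  assume "[\<theta> = 0] (rmod 2 * pi)"
  then have "[0 = \<theta>] (rmod 2 * pi)" by (rule rcong_sym)
  then obtain n :: int where "\<theta> = n * (2 * pi)"
    by (auto simp: rcong_altdef)
  then show "cis \<theta> = 1"
    using cis_multiple_2pi[of "of_int n"] by (simp add: mult_ac)
qed

lemma cis_eq_minus_1_iff_rcong: "cis \<theta> = -1 \<longleftrightarrow> [\<theta> = pi] (rmod 2 * pi)"
proof -
  have "cis \<theta> = -1 \<longleftrightarrow> cis (\<theta> - pi) = 1"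
    by (auto simp: minus_equation_iff[of _ 1] simp flip: cis_divide)
  also have "\<dots> \<longleftrightarrow> [\<theta> = pi] (rmod 2 * pi)"
    unfolding cis_eq_1_iff_rcong using rcong_diff_right_cancel[of \<theta> pi pi "2 * pi"] by simp
  finally show ?thesis .
qed

text \<open>With h half the angle, 1 + i tan h and 1 - i tan h are \<open>cis\<close> of h and of
  -h, each divided by cos h, so their quotient is \<open>cis\<close> of 2h. If cos h = 0, then
  \<open>cis\<close> of h squares to -1, which is the case of the point at infinity.\<close>

lemma cayley_half_tan: "cayley (half_tan \<rho>) = cis \<rho>"
proof (cases "cis \<rho> = -1")
  case True
  then show ?thesis by (simp add: half_tan_def cis_eq_minus_1_iff_rcong[symmetric])
next
  case False
  have "cos (\<rho> / 2) \<noteq> 0"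
  proof
    assume "cos (\<rho> / 2) = 0"
    then have "cis (\<rho> / 2) = \<i> * sin (\<rho> / 2)" "(sin (\<rho> / 2))\<^sup>2 = 1"
      using sin_cos_squared_add[of "\<rho> / 2"] by (simp_all add: complex_eq_iff)
    then have "cis (\<rho> / 2) ^ 2 = -1"
      by (simp add: power_mult_distrib flip: of_real_power)
    then show False using False by (simp add: power2_eq_square cis_mult)
  qed
  then have "1 + \<i> * tan (\<rho> / 2) = cis (\<rho> / 2) / cos (\<rho> / 2)"
    "1 - \<i> * tan (\<rho> / 2) = cis (- (\<rho> / 2)) / cos (\<rho> / 2)"
    by (simp_all add: complex_eq_iff tan_def)
  then show ?thesis
    using False \<open>cos (\<rho> / 2) \<noteq> 0\<close>
    by (simp add: half_tan_def cayley_Some cis_eq_minus_1_iff_rcong[symmetric] cis_divide)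
qed

lemma cis_Arg_unit: "norm u = 1 \<Longrightarrow> cis (Arg u) = u"
  by (subst cis_Arg) (auto simp: sgn_eq)

lemma cayley_surj: "norm u = 1 \<Longrightarrow> \<exists>p. cayley p = u"
  using cis_Arg_unit cayley_half_tan by metis

lemma surj_half_tan: "\<exists>\<rho>. half_tan \<rho> = p"
proof -
  have "cayley (half_tan (Arg (cayley p))) = cayley p"
    by (simp add: cayley_half_tan cis_Arg_unit)
  then show ?thesis using inj_cayley by (auto dest: injD)
qed


section \<open>Configurations of the deltoid\<close>

text \<open>The closing conditions see the angles only through \<open>cis\<close>, hence only
  through the half-tangents. Since \<open>half_tan\<close> is surjective, the existential
  quantifiers over angles then disappear.\<close>

lemma linkage_configs_iff:
  "(x, y, z, w) \<in> linkage_configs \<alpha> \<beta> \<gamma> \<delta> \<longleftrightarrow>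
     cayley x * cayley y * cayley z * cayley w = 1 \<and>
     \<beta> + \<gamma> * cayley y + \<delta> * (cayley y * cayley z) + \<alpha> * (cayley y * cayley z * cayley w) = 0"
proof -
  have angles: "linkage_angles \<alpha> \<beta> \<gamma> \<delta> a b c d \<longleftrightarrow> cis a * cis b * cis c * cis d = 1 \<and>
     \<beta> + \<gamma> * cis b + \<delta> * (cis b * cis c) + \<alpha> * (cis b * cis c * cis d) = 0" for a b c d
    unfolding linkage_angles_def cis_conv_exp[symmetric] cis_eq_1_iff_rcong[symmetric]
    by (simp add: cis_mult)
  have "(x, y, z, w) \<in> linkage_configs \<alpha> \<beta> \<gamma> \<delta> \<longleftrightarrow> (\<exists>a b c d. x = half_tan a \<and>
      y = half_tan b \<and> z = half_tan c \<and> w = half_tan d \<and> linkage_angles \<alpha> \<beta> \<gamma> \<delta> a b c d)"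
    by (auto simp: linkage_configs_def)
  also have "\<dots> \<longleftrightarrow> (\<exists>a b c d. x = half_tan a \<and> y = half_tan b \<and> z = half_tan c \<and> w = half_tan d) \<and>
      cayley x * cayley y * cayley z * cayley w = 1 \<and>
      \<beta> + \<gamma> * cayley y + \<delta> * (cayley y * cayley z) + \<alpha> * (cayley y * cayley z * cayley w) = 0"
    unfolding angles cayley_half_tan[symmetric] by blast
  finally show ?thesis using surj_half_tan by metis
qed

text \<open>Multiplying the closing equation by the nonzero X makes its last term \<beta> XYZW =
  \<beta>, and the four terms group in pairs.\<close>

lemma deltoid_configs_iff:
  "(x, y, z, w) \<in> linkage_configs \<beta> \<beta> \<gamma> \<gamma> \<longleftrightarrow>
     cayley x * cayley y * cayley z * cayley w = 1 \<and>
     \<beta> * (1 + cayley x) + \<gamma> * (cayley x * cayley y * (1 + cayley z)) = 0"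
proof -
  have "\<beta> + \<gamma> * Y + \<gamma> * (Y * Z) + \<beta> * (Y * Z * W) = 0 \<longleftrightarrow>
      \<beta> * (1 + X) + \<gamma> * (X * Y * (1 + Z)) = 0"
    if "X * Y * Z * W = 1" "X \<noteq> 0" for X Y Z W :: complex
  proof -
    have "X * (\<beta> + \<gamma> * Y + \<gamma> * (Y * Z) + \<beta> * (Y * Z * W)) =
        \<beta> * X + \<gamma> * (X * Y * (1 + Z)) + \<beta> * (X * Y * Z * W)"
      by (simp add: algebra_simps)
    also have "\<dots> = \<beta> * (1 + X) + \<gamma> * (X * Y * (1 + Z))"
      using that by (simp add: algebra_simps)
    finally show ?thesis using that(2) by (metis mult_eq_0_iff)
  qed
  then show ?thesis unfolding linkage_configs_iff using cayley_neq_0 by blast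
qed

text \<open>With X = -1 the second equation leaves only \<gamma> Y (1 + Z) = 0. Then Z = -1, so the
  first one says YW = 1, and inversion on the circle is negation of the coordinate.\<close>

lemma deltoid_configs_Infty_iff:
  assumes "\<gamma> \<noteq> 0"
  shows "(None, y, z, w) \<in> linkage_configs \<beta> \<beta> \<gamma> \<gamma> \<longleftrightarrow> z = None \<and> w = neg1 y"
proof -
  have "w = neg1 y \<longleftrightarrow> cayley w = inverse (cayley y)"
    using inj_cayley cayley_neg1 by (metis injD)
  also have "\<dots> \<longleftrightarrow> cayley y * cayley w = 1"
    by (simp add: field_simps)
  finally have w: "w = neg1 y \<longleftrightarrow> cayley y * cayley w = 1" .
  have "1 + cayley z = 0 \<longleftrightarrow> z = None"
    using cayley_eq_minus_1_iff[of z] by (metis add_eq_0_iff)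
  then show ?thesis
    using assms w unfolding deltoid_configs_iff by (cases "z = None") auto
qed

lemma deltoid_configs_Some_iff_cayley:
  assumes "\<beta> \<noteq> 0" "\<gamma> \<noteq> 0"
  shows "(Some x, y, z, w) \<in> linkage_configs \<beta> \<beta> \<gamma> \<gamma> \<longleftrightarrow> y = w \<and>
    \<beta> * (1 + cayley (Some x)) + \<gamma> * (cayley (Some x) * cayley y * (1 + cayley z)) = 0"
proof -
  define X Y Z W where defs: "X = cayley (Some x)" "Y = cayley y" "Z = cayley z" "W = cayley w"
  have nz: "X \<noteq> 0" "Y \<noteq> 0" "Z \<noteq> 0" "W \<noteq> 0" unfolding defs by auto
  have X: "1 + X \<noteq> 0" using cayley_Some_neq[of x] unfolding defs by (metis add_eq_0_iff)
  have "X * Y * Z * W = 1 \<longleftrightarrow> Y = W" if eq: "\<beta> * (1 + X) + \<gamma> * (X * Y * (1 + Z)) = 0"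
  proof -
    have Z: "1 + Z \<noteq> 0" using eq X assms by auto
    \<comment> \<open>Cayley values have modulus one, so conjugation inverts X, Y and Z; multiplying
      by XYZ then clears the denominators.\<close>
    have "cnj (\<beta> * (1 + X) + \<gamma> * (X * Y * (1 + Z))) = 0" unfolding eq by simp
    then have "\<beta> * (1 + inverse X) + \<gamma> * (inverse X * inverse Y * (1 + inverse Z)) = 0"
      unfolding defs by (simp only: complex_cnj_add complex_cnj_mult complex_cnj_one
          complex_cnj_complex_of_real cnj_cayley)
    moreover have "X * Y * Z * (\<beta> * (1 + inverse X) + \<gamma> * (inverse X * inverse Y * (1 + inverse Z))) =
        Y * Z * (\<beta> * (1 + X)) + \<gamma> * (1 + Z)"
      using nz by (simp add: field_simps)
    ultimately have "Y * Z * (\<beta> * (1 + X)) + \<gamma> * (1 + Z) = 0"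
      by simp
    moreover have b: "\<beta> * (1 + X) = - (\<gamma> * (X * Y * (1 + Z)))"
      using eq by (simp add: eq_neg_iff_add_eq_0)
    \<comment> \<open>Inserting the original equation into its conjugate splits off the nonzero
      factor \<gamma> (1 + Z). What remains is the first closing condition with Y in place of W, so
      it holds for W exactly if W = Y.\<close>
    have "Y * Z * (\<beta> * (1 + X)) + \<gamma> * (1 + Z) = \<gamma> * (1 + Z) * (1 - X * Y * Z * Y)"
      unfolding b by (simp add: algebra_simps)
    ultimately have "\<gamma> * (1 + Z) * (1 - X * Y * Z * Y) = 0"
      by simp
    then have 1: "X * Y * Z * Y = 1" using Z assms by simp
    show ?thesis
    proof
      assume "X * Y * Z * W = 1"
      then have "(X * Y * Z) * W = (X * Y * Z) * Y" using 1 by simp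
      then show "Y = W" using nz by simp
    qed (use 1 in simp)
  qed
  moreover have "Y = W \<longleftrightarrow> y = w"
    unfolding defs using inj_cayley by (auto dest: injD)
  ultimately show ?thesis unfolding deltoid_configs_iff defs by blast
qed

text \<open>Since 1 + (1 + it)/(1 - it) = 2/(1 - it), both sums contribute the same factor 2, and
  the common factor 2/(abc) is nonzero.\<close>

lemma deltoid_configs_Some_iff_complex:
  assumes "\<beta> \<noteq> 0" "\<gamma> \<noteq> 0"
  shows "(Some x, Some y, Some z, Some w) \<in> linkage_configs \<beta> \<beta> \<gamma> \<gamma> \<longleftrightarrow> y = w \<and>
    \<beta> * ((1 - \<i> * y) * (1 - \<i> * z)) + \<gamma> * ((1 + \<i> * x) * (1 + \<i> * y)) = 0"
proof -
  define a b c where abc: "a = 1 - \<i> * x" "b = 1 - \<i> * y" "c = 1 - \<i> * z"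
  have nz: "a \<noteq> 0" "b \<noteq> 0" "c \<noteq> 0" using one_plus_minus_ii_neq_0 unfolding abc by auto
  have s: "1 + cayley (Some x) = 2 / a" "1 + cayley (Some z) = 2 / c"
    using nz by (simp_all add: cayley_Some abc field_simps)
  have "\<beta> * (1 + cayley (Some x)) + \<gamma> * (cayley (Some x) * cayley (Some y) * (1 + cayley (Some z)))
      = 2 / (a * b * c) * (\<beta> * (b * c) + \<gamma> * ((1 + \<i> * x) * (1 + \<i> * y)))"
    (is "?L = ?k * ?R")
    unfolding s using nz by (simp add: cayley_Some field_simps flip: abc)
  moreover have "?k \<noteq> 0" using nz by simp
  ultimately have "?L = 0 \<longleftrightarrow> ?R = 0" by (metis mult_eq_0_iff)
  then show ?thesis
    unfolding deltoid_configs_Some_iff_cayley[OF assms] abc(2,3) by blast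
qed

text \<open>An infinite z would leave \<beta> (1 + X) = 0. An infinite y means Y = -1, and clearing
  denominators gives \<beta> (1 - it) = \<gamma> (1 + ix), whose real part is the excluded \<beta> =
  \<gamma>.\<close>

lemma deltoid_configs_finite:
  assumes "\<beta> \<noteq> 0" "\<gamma> \<noteq> 0" "\<gamma> \<noteq> \<beta>" "(Some x, y, z, w) \<in> linkage_configs \<beta> \<beta> \<gamma> \<gamma>"
  shows "y \<noteq> None" "z \<noteq> None" "w \<noteq> None"
proof -
  have eq: "y = w" "\<beta> * (1 + cayley (Some x)) + \<gamma> * (cayley (Some x) * cayley y * (1 + cayley z)) = 0"
    using assms deltoid_configs_Some_iff_cayley by auto
  have X: "1 + cayley (Some x) \<noteq> 0"
    using cayley_Some_neq[of x] by (metis add_eq_0_iff)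
  show z: "z \<noteq> None"
  proof
    assume "z = None"
    then show False using eq X assms(1) by simp
  qed
  show "y \<noteq> None"
  proof
    assume "y = None"
    obtain t where t: "z = Some t" using z by auto
    define a c where ac: "a = 1 - \<i> * x" "c = 1 - \<i> * t"
    have nz: "a \<noteq> 0" "c \<noteq> 0" using one_plus_minus_ii_neq_0 unfolding ac by auto
    have s: "1 + cayley (Some x) = 2 / a" "1 + cayley z = 2 / c"
      using nz by (simp_all add: t cayley_Some ac field_simps)
    have "\<beta> * (2 / a) - \<gamma> * ((1 + \<i> * x) / a * (2 / c)) = 0"
      using eq(2) unfolding s \<open>y = None\<close> by (simp add: cayley_Some ac)
    then have "2 * (\<beta> * c) = 2 * (\<gamma> * (1 + \<i> * x))"
      using nz by (simp add: field_simps)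
    then have "\<beta> * c = \<gamma> * (1 + \<i> * x)"
      by (subst (asm) mult_cancel_left) simp
    then show False using assms(3) by (auto simp: ac complex_eq_iff)
  qed
  then show "w \<noteq> None" using eq by simp
qed

lemma deltoid_configs_real_iff:
  assumes "\<beta> > 0" "\<gamma> > 0" "\<gamma> \<noteq> \<beta>"
  shows "(Some x, Some y, Some z, Some w) \<in> linkage_configs \<beta> \<beta> \<gamma> \<gamma> \<longleftrightarrow>
    y = w \<and> y = (\<gamma> * x - \<beta> * z) / (\<beta> - \<gamma>) \<and> (\<beta> * z)\<^sup>2 = \<gamma>\<^sup>2 * (x\<^sup>2 + 1) - \<beta>\<^sup>2"
proof -
  \<comment> \<open>Real and imaginary parts.\<close>
  have "complex_of_real \<beta> * ((1 - \<i> * y) * (1 - \<i> * z)) + \<gamma> * ((1 + \<i> * x) * (1 + \<i> * y)) = 0 \<longleftrightarrow>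
      \<beta> * (1 - y * z) + \<gamma> * (1 - x * y) = 0 \<and> \<beta> * (y + z) = \<gamma> * (x + y)"
    by (auto simp: complex_eq_iff algebra_simps)
  \<comment> \<open>The real part is multiplied by the nonzero \<beta> - \<gamma>. Then y can be
    eliminated by means of the linear equation, which leaves a difference of squares free of
    y.\<close>
  also have "\<dots> \<longleftrightarrow> (\<beta> - \<gamma>) * ((\<beta> + \<gamma>) - y * (\<beta> * z + \<gamma> * x)) = 0 \<and> y * (\<beta> - \<gamma>) = \<gamma> * x - \<beta> * z"
  proof -
    have "\<beta> * (1 - y * z) + \<gamma> * (1 - x * y) = (\<beta> + \<gamma>) - y * (\<beta> * z + \<gamma> * x)"
      by (simp add: algebra_simps)
    moreover have "\<beta> * (y + z) = \<gamma> * (x + y) \<longleftrightarrow> y * (\<beta> - \<gamma>) = \<gamma> * x - \<beta> * z"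
      by (auto simp: algebra_simps)
    ultimately show ?thesis using assms by simp
  qed
  also have "\<dots> \<longleftrightarrow> (\<beta> - \<gamma>) * (\<beta> + \<gamma>) - (\<gamma> * x - \<beta> * z) * (\<beta> * z + \<gamma> * x) = 0
      \<and> y * (\<beta> - \<gamma>) = \<gamma> * x - \<beta> * z"
  proof (rule rev_conj_cong[OF refl])
    assume e: "y * (\<beta> - \<gamma>) = \<gamma> * x - \<beta> * z"
    show "(\<beta> - \<gamma>) * ((\<beta> + \<gamma>) - y * (\<beta> * z + \<gamma> * x)) = 0 \<longleftrightarrow>
      (\<beta> - \<gamma>) * (\<beta> + \<gamma>) - (\<gamma> * x - \<beta> * z) * (\<beta> * z + \<gamma> * x) = 0"
      unfolding e[symmetric] by (simp add: algebra_simps)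
  qed
  also have "\<dots> \<longleftrightarrow> (\<beta> * z)\<^sup>2 = \<gamma>\<^sup>2 * (x\<^sup>2 + 1) - \<beta>\<^sup>2 \<and> y = (\<gamma> * x - \<beta> * z) / (\<beta> - \<gamma>)"
    using assms by (auto simp: field_simps power2_eq_square)
  finally show ?thesis
    using assms deltoid_configs_Some_iff_complex[of \<beta> \<gamma> x y z w] by auto
qed

text \<open>The stated domain is where the radicand is nonnegative; for \<beta> at most \<gamma>
  this is automatic.\<close>

lemma deltoid_domain_iff:
  fixes x :: real
  assumes "\<beta> > 0" "\<gamma> > 0"
  shows "x \<in> (if \<beta> > \<gamma> then {.. - sqrt (\<beta>\<^sup>2 / \<gamma>\<^sup>2 - 1)} \<union> {sqrt (\<beta>\<^sup>2 / \<gamma>\<^sup>2 - 1) ..} else UNIV)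
    \<longleftrightarrow> 0 \<le> \<gamma>\<^sup>2 * (x\<^sup>2 + 1) - \<beta>\<^sup>2"
proof (cases "\<beta> > \<gamma>")
  case True
  \<comment> \<open>The left side says that \<open>sqrt k\<close> is at most |x| =
    \<open>sqrt (x\<^sup>2)\<close>. The sign of \<open>k\<close> does not matter because
    \<open>sqrt\<close> is strictly increasing on the whole line.\<close>
  have "x \<le> - sqrt k \<or> sqrt k \<le> x \<longleftrightarrow> k \<le> x\<^sup>2" for k
    using real_sqrt_le_iff[of k "x\<^sup>2"] by auto
  moreover have "\<beta>\<^sup>2 / \<gamma>\<^sup>2 - 1 \<le> x\<^sup>2 \<longleftrightarrow> 0 \<le> \<gamma>\<^sup>2 * (x\<^sup>2 + 1) - \<beta>\<^sup>2"
    using assms by (auto simp: field_simps)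
  ultimately show ?thesis using True by simp
next
  case False
  then have "\<beta>\<^sup>2 \<le> \<gamma>\<^sup>2" using assms by (simp add: power_mono)
  also have "\<gamma>\<^sup>2 \<le> \<gamma>\<^sup>2 * (x\<^sup>2 + 1)" by (simp add: algebra_simps)
  finally show ?thesis using False by simp
qed


section \<open>The branch at infinity is a circle\<close>

lemma image_line_chart: "(U, \<phi>) \<in> line_atlas \<Longrightarrow> \<phi> ` U = UNIV"
proof -
  have "the ` (UNIV - {None}) = (UNIV :: real set)" "recip_coord ` (UNIV - {Some 0}) = UNIV"
    unfolding the_image recip_coord_image by auto
  then show "(U, \<phi>) \<in> line_atlas \<Longrightarrow> \<phi> ` U = UNIV"
    by (auto simp: line_atlas_def)
qed

lemma prod_atlasI:
  "(U, \<phi>) \<in> A \<Longrightarrow> (V, \<psi>) \<in> B \<Longrightarrow> (U \<times> V, map_prod \<phi> \<psi>) \<in> prod_atlas A B"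
  by (auto simp: prod_atlas_def)

text \<open>The full image allows local representatives of maps out of the branch to be given on the
  whole Euclidean space.\<close>

lemma line_atlas4I:
  assumes "(U1, \<phi>1) \<in> line_atlas" "(U2, \<phi>2) \<in> line_atlas" "(U3, \<phi>3) \<in> line_atlas" "(U4, \<phi>4) \<in> line_atlas"
  shows "(U1 \<times> U2 \<times> U3 \<times> U4, map_prod \<phi>1 (map_prod \<phi>2 (map_prod \<phi>3 \<phi>4))) \<in> line_atlas4"
    "map_prod \<phi>1 (map_prod \<phi>2 (map_prod \<phi>3 \<phi>4)) ` (U1 \<times> U2 \<times> U3 \<times> U4) = UNIV"
proof -
  show "(U1 \<times> U2 \<times> U3 \<times> U4, map_prod \<phi>1 (map_prod \<phi>2 (map_prod \<phi>3 \<phi>4))) \<in> line_atlas4"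
    unfolding line_atlas4_def by (intro prod_atlasI assms)
  show "map_prod \<phi>1 (map_prod \<phi>2 (map_prod \<phi>3 \<phi>4)) ` (U1 \<times> U2 \<times> U3 \<times> U4) = UNIV"
    using assms[THEN image_line_chart] by (simp add: map_prod_surj_on)
qed

lemma recip_chart: "(UNIV - {Some 0}, recip_coord) \<in> line_atlas"
  and the_chart: "(UNIV - {None}, the) \<in> line_atlas"
  by (auto simp: line_atlas_def)

lemma smooth_on_cayley: "smooth_on UNIV (\<lambda>q::real \<times> real \<times> real \<times> real.
    (1 + \<i> * complex_of_real (fst (snd q))) / (1 - \<i> * complex_of_real (fst (snd q))))" (is ?A)
  and smooth_on_cayley_recip: "smooth_on UNIV (\<lambda>q::real \<times> real \<times> real \<times> real.
    (complex_of_real (fst (snd q)) + \<i>) / (complex_of_real (fst (snd q)) - \<i>))" (is ?B)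
proof -
  let ?t = "\<lambda>q::real \<times> real \<times> real \<times> real. complex_of_real (fst (snd q))"
  have t: "bounded_linear ?t"
    by (intro bounded_linear_compose[OF bounded_linear_of_real]
        bounded_linear_compose[OF bounded_linear_fst bounded_linear_snd])
  \<comment> \<open>Subtraction is written as addition of a multiple by -i to fit the closure rules.
    The denominator has real part 1, so it never vanishes.\<close>
  have "smooth_on UNIV (\<lambda>q. (1 + \<i> * ?t q) / (1 + - \<i> * ?t q))"
    by (intro smooth_on_divide smooth_on_add smooth_on_mult smooth_on_const smooth_on_bounded_linear t)
       (auto simp: complex_eq_iff)
  then show ?A by simp
  have "smooth_on UNIV (\<lambda>q. (?t q + \<i>) / (?t q + - \<i>))"
    by (intro smooth_on_divide smooth_on_add smooth_on_const smooth_on_bounded_linear t)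
       (auto simp: complex_eq_iff)
  then show ?B by simp
qed

text \<open>Dividing numerator and denominator by t gives a formula in s = 1/t that stays smooth at
  s = 0, where its value is -1.\<close>

lemma cayley_recip_coord:
  "p \<noteq> Some 0 \<Longrightarrow> cayley p = (recip_coord p + \<i>) / (recip_coord p - \<i>)"
proof (cases p)
  case (Some t)
  moreover assume "p \<noteq> Some 0"
  ultimately show ?thesis
    using one_plus_minus_ii_neq_0[of t] by (simp add: recip_coord_def cayley_Some field_simps)
qed (simp add: recip_coord_def divide_eq_eq)

lemma Re_Im_cayley_Some:
  "Re (cayley (Some t)) = (1 - t\<^sup>2) / (1 + t\<^sup>2)" "Im (cayley (Some t)) = 2 * t / (1 + t\<^sup>2)"
  by (simp_all add: cayley_Some Re_divide Im_divide power2_eq_square)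

text \<open>This is tan(r/2) = sin r / (1 + cos r), the stereographic projection from -1. The next
  lemma is the cotangent analogue, the projection from 1, which also covers the point at
  infinity.\<close>

lemma the_cayley: "t = Im (cayley (Some t)) / (1 + Re (cayley (Some t)))"
proof -
  have nz: "1 + t\<^sup>2 \<noteq> 0" using zero_le_power2[of t] by linarith
  then have "1 + Re (cayley (Some t)) = 2 / (1 + t\<^sup>2)"
    by (simp add: Re_Im_cayley_Some field_simps)
  then show ?thesis using nz by (simp add: Re_Im_cayley_Some)
qed

lemma recip_coord_cayley:
  assumes "p \<noteq> Some 0"
  shows "recip_coord p = Im (cayley p) / (1 - Re (cayley p))"
proof (cases p)
  case (Some t)
  have nz: "1 + t\<^sup>2 \<noteq> 0" using zero_le_power2[of t] by linarith
  then have "1 - Re (cayley (Some t)) = 2 * t\<^sup>2 / (1 + t\<^sup>2)"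
    by (simp add: Re_Im_cayley_Some field_simps)
  then show ?thesis
    using nz assms Some by (simp add: Re_Im_cayley_Some recip_coord_def power2_eq_square)
qed (simp add: recip_coord_def)

text \<open>In both product charts used below the branch is the line of points (0, r, 0, -r):
  infinity has reciprocal coordinate 0, and \<open>neg1\<close> negates either coordinate.
  Smoothness into the branch thus reduces to that of r.\<close>

lemma bounded_linear_branch:
  "bounded_linear (\<lambda>r::real. (0, r, 0, - r) :: real \<times> real \<times> real \<times> real)"
  by (intro bounded_linear_Pair bounded_linear_zero bounded_linear_ident
      bounded_linear_minus[OF bounded_linear_ident])

lemma branch_diffeomorphic_circle:
  "diffeomorphic line_atlas4 {(Infty, y, Infty, neg1 y) | y. True}
     euclidean_atlas (sphere (0::complex) 1)"
proof -
  let ?S = "{(Infty, y, Infty, neg1 y) | y. True}"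
  let ?C = "sphere (0::complex) 1"
  define f :: "real_infty \<times> real_infty \<times> real_infty \<times> real_infty \<Rightarrow> complex"
    where "f p = cayley (fst (snd p))" for p
  define g where "g u = (None :: real_infty, inv cayley u, None :: real_infty, neg1 (inv cayley u))" for u
  have gf: "g (f p) = p" if "p \<in> ?S" for p
    using that by (auto simp: f_def g_def inv_f_f inj_cayley)
  have fg: "f (g u) = u" if "u \<in> ?C" for u
    using that cayley_surj[of u] by (auto simp: f_def g_def f_inv_into_f)
  have fS: "f p \<in> ?C" for p by (simp add: f_def)
  have gC: "g u \<in> ?S" for u by (auto simp: g_def)
  have "smooth_map_on line_atlas4 ?S euclidean_atlas f"
    unfolding smooth_map_on_def
  proof
    fix p assume "p \<in> ?S"
    then obtain y where p: "p = (None, y, None, neg1 y)" by auto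
    define R R0 where "R = UNIV - {Some (0::real)}" and "R0 = UNIV - {None :: real_infty}"
    note chart = recip_chart[folded R_def] the_chart[folded R0_def]
    have "\<exists>U \<phi> g. (U, \<phi>) \<in> line_atlas4 \<and> \<phi> ` U = UNIV \<and> p \<in> U \<and> smooth_on UNIV g \<and>
        (\<forall>q\<in>?S \<inter> U. f q = g (\<phi> q))"
    \<comment> \<open>The first and third entries are infinite and require the reciprocal chart. The
      second and fourth are infinite together, so they change charts together.\<close>
    proof (cases y)
      case None
      let ?\<phi> = "map_prod recip_coord (map_prod recip_coord (map_prod recip_coord recip_coord))"
      have "p \<in> R \<times> R \<times> R \<times> R" by (simp add: R_def p None neg1_def)
      moreover have "\<forall>q\<in>?S \<inter> (R \<times> R \<times> R \<times> R). f q =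
          (complex_of_real (fst (snd (?\<phi> q))) + \<i>) / (complex_of_real (fst (snd (?\<phi> q))) - \<i>)"
        by (auto simp: f_def R_def cayley_recip_coord)
      ultimately show ?thesis
        using line_atlas4I[OF chart(1) chart(1) chart(1) chart(1)] smooth_on_cayley_recip by blast
    next
      case (Some t)
      let ?\<phi> = "map_prod recip_coord (map_prod the (map_prod recip_coord the))"
      have "p \<in> R \<times> R0 \<times> R \<times> R0" by (simp add: R_def R0_def p Some neg1_def)
      moreover have "\<forall>q\<in>?S \<inter> (R \<times> R0 \<times> R \<times> R0). f q =
          (1 + \<i> * complex_of_real (fst (snd (?\<phi> q)))) / (1 - \<i> * complex_of_real (fst (snd (?\<phi> q))))"
        by (auto simp: f_def R0_def cayley_Some)
      ultimately show ?thesis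
        using line_atlas4I[OF chart(1) chart(2) chart(1) chart(2)] smooth_on_cayley by blast
    qed
    then obtain U \<phi> h where h: "(U, \<phi>) \<in> line_atlas4" "\<phi> ` U = UNIV" "p \<in> U" "smooth_on UNIV h"
      "\<forall>q\<in>?S \<inter> U. f q = h (\<phi> q)" by blast
    show "\<exists>U \<phi> V \<psi>. (U, \<phi>) \<in> line_atlas4 \<and> p \<in> U \<and> (V, \<psi>) \<in> euclidean_atlas \<and> f p \<in> V \<and>
        (\<exists>W g. open W \<and> \<phi> p \<in> W \<and> W \<subseteq> \<phi> ` U \<and> smooth_on W g \<and>
           (\<forall>q\<in>?S \<inter> U. \<phi> q \<in> W \<longrightarrow> f q \<in> V \<and> \<psi> (f q) = g (\<phi> q)))"
      by (rule exI[of _ U], rule exI[of _ \<phi>], rule exI[of _ UNIV], rule exI[of _ "\<lambda>x. x"],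
          intro conjI exI[of _ UNIV] exI[of _ h]) (use h in \<open>auto simp: euclidean_atlas_def\<close>)
  qed
  moreover have "smooth_map_on euclidean_atlas ?C line_atlas4 g"
    unfolding smooth_map_on_def
  proof
    fix u assume u: "u \<in> ?C"
    define R R0 where "R = UNIV - {Some (0::real)}" and "R0 = UNIV - {None :: real_infty}"
    note chart = recip_chart[folded R_def] the_chart[folded R0_def]
    have "\<exists>V \<psi> W h. (V, \<psi>) \<in> line_atlas4 \<and> open W \<and> u \<in> W \<and> smooth_on W h \<and>
        (\<forall>q\<in>?C \<inter> W. g q \<in> V \<and> \<psi> (g q) = h q)"
    \<comment> \<open>The point -1 corresponds to infinite y. In each case \<open>?W\<close> removes
      the line on which the denominator of the inverse formula vanishes; on the circle this is the
      single point 1 or -1.\<close>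
    proof (cases "u = -1")
      case True
      let ?W = "{q. Re q \<noteq> 1}"
      let ?h = "\<lambda>q. (0, Im q / (1 - Re q), 0, - (Im q / (1 - Re q))) :: real \<times> real \<times> real \<times> real"
      let ?\<psi> = "map_prod recip_coord (map_prod recip_coord (map_prod recip_coord recip_coord))"
      have "open ?W" by (intro open_Collect_neq continuous_intros)
      moreover have "u \<in> ?W" using True by simp
      moreover have "smooth_on ?W ?h"
      proof (rule smooth_on_bounded_linear_compose[OF \<open>open ?W\<close> bounded_linear_branch])
        have "smooth_on ?W (\<lambda>q. Im q / (1 + - Re q))"
          using \<open>open ?W\<close>
          by (intro smooth_on_divide smooth_on_add smooth_on_const smooth_on_bounded_linear
              bounded_linear_Im bounded_linear_minus[OF bounded_linear_Re]) auto
        then show "smooth_on ?W (\<lambda>q. Im q / (1 - Re q))" by simp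
      qed
      moreover have "g q \<in> R \<times> R \<times> R \<times> R \<and> ?\<psi> (g q) = ?h q" if q: "q \<in> ?C \<inter> ?W" for q
      proof -
        obtain y where y: "cayley y = q" using q cayley_surj[of q] by (metis IntD1 mem_sphere_0)
        then have "inv cayley q = y" using inj_cayley by (metis inv_f_f)
        moreover have "y \<noteq> Some 0" using q y by (auto simp: cayley_Some)
        ultimately show ?thesis
          using recip_coord_cayley[of y] y by (cases y) (auto simp: g_def R_def neg1_def recip_coord_def)
      qed
      ultimately show ?thesis
        using line_atlas4I(1)[OF chart(1) chart(1) chart(1) chart(1)] by blast
    next
      case False
      let ?W = "{q. Re q \<noteq> -1}"
      let ?h = "\<lambda>q. (0, Im q / (1 + Re q), 0, - (Im q / (1 + Re q))) :: real \<times> real \<times> real \<times> real"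
      let ?\<psi> = "map_prod recip_coord (map_prod the (map_prod recip_coord the))"
      have "open ?W" by (intro open_Collect_neq continuous_intros)
      moreover have "u \<in> ?W"
      proof -
        have "u = -1" if "Re u = -1"
          using u that by (auto simp: cmod_def complex_eq_iff)
        then show ?thesis using False by blast
      qed
      moreover have "smooth_on ?W ?h"
      proof (rule smooth_on_bounded_linear_compose[OF \<open>open ?W\<close> bounded_linear_branch])
        show "smooth_on ?W (\<lambda>q. Im q / (1 + Re q))"
          using \<open>open ?W\<close>
          by (intro smooth_on_divide smooth_on_add smooth_on_const smooth_on_bounded_linear
              bounded_linear_Im bounded_linear_Re) (auto simp: add_eq_0_iff)
      qed
      moreover have "g q \<in> R \<times> R0 \<times> R \<times> R0 \<and> ?\<psi> (g q) = ?h q" if q: "q \<in> ?C \<inter> ?W" for q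
      proof -
        obtain y where y: "cayley y = q" using q cayley_surj[of q] by (metis IntD1 mem_sphere_0)
        then have "inv cayley q = y" using inj_cayley by (metis inv_f_f)
        moreover obtain t where "y = Some t" using q y by (cases y) auto
        ultimately show ?thesis
          using the_cayley[of t] y by (auto simp: g_def R_def R0_def neg1_def recip_coord_def)
      qed
      ultimately show ?thesis
        using line_atlas4I(1)[OF chart(1) chart(2) chart(1) chart(2)] by blast
    qed
    then obtain V \<psi> W h where h: "(V, \<psi>) \<in> line_atlas4" "open W" "u \<in> W" "smooth_on W h"
      "\<forall>q\<in>?C \<inter> W. g q \<in> V \<and> \<psi> (g q) = h q" by blast
    show "\<exists>U \<phi> V \<psi>. (U, \<phi>) \<in> euclidean_atlas \<and> u \<in> U \<and> (V, \<psi>) \<in> line_atlas4 \<and> g u \<in> V \<and>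
        (\<exists>W h. open W \<and> \<phi> u \<in> W \<and> W \<subseteq> \<phi> ` U \<and> smooth_on W h \<and>
           (\<forall>q\<in>?C \<inter> U. \<phi> q \<in> W \<longrightarrow> g q \<in> V \<and> \<psi> (g q) = h (\<phi> q)))"
      by (rule exI[of _ UNIV], rule exI[of _ "\<lambda>x. x"], rule exI[of _ V], rule exI[of _ \<psi>],
          intro conjI exI[of _ W] exI[of _ h]) (use h u in \<open>auto simp: euclidean_atlas_def\<close>)
  qed
  moreover have "f ` ?S = ?C"
    using fg fS gC by (metis (no_types, lifting) image_eqI image_subsetI subsetI subset_antisym)
  moreover have "g ` ?C = ?S"
    using gf fS gC by (metis (no_types, lifting) image_eqI image_subsetI subsetI subset_antisym)
  ultimately show ?thesis
    unfolding diffeomorphic_def using gf fg by blast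
qed


section \<open>The configurations of the deltoid II\<close>

theorem mainTheorem5:
  fixes \<alpha> \<beta> \<gamma> \<delta> :: real
  assumes "\<beta> > 0" and "\<gamma> > 0" and "\<gamma> \<noteq> \<beta>" and "\<alpha> = \<beta>" and "\<delta> = \<gamma>"
  shows
    "{(x, y, z, w) \<in> linkage_configs \<alpha> \<beta> \<gamma> \<delta>. x \<noteq> Infty} =
       {(Some x, Some y, Some z, Some w) | x y z w :: real.
          x \<in> (if \<beta> > \<gamma>
               then {.. - sqrt (\<beta>\<^sup>2 / \<gamma>\<^sup>2 - 1)} \<union> {sqrt (\<beta>\<^sup>2 / \<gamma>\<^sup>2 - 1) ..}
               else UNIV) \<and>
          (y = w \<and> w = (\<gamma> * x + sqrt (\<gamma>\<^sup>2 * (x\<^sup>2 + 1) - \<beta>\<^sup>2)) / (\<beta> - \<gamma>) \<and>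
             z = - (sqrt (\<gamma>\<^sup>2 * (x\<^sup>2 + 1) - \<beta>\<^sup>2) / \<beta>) \<or>
           y = w \<and> w = (\<gamma> * x - sqrt (\<gamma>\<^sup>2 * (x\<^sup>2 + 1) - \<beta>\<^sup>2)) / (\<beta> - \<gamma>) \<and>
             z = sqrt (\<gamma>\<^sup>2 * (x\<^sup>2 + 1) - \<beta>\<^sup>2) / \<beta>)}
     \<and> {(x, y, z, w) \<in> linkage_configs \<alpha> \<beta> \<gamma> \<delta>.
          x = Infty \<or> y = Infty \<or> z = Infty \<or> w = Infty} =
       {(Infty, y, Infty, neg1 y) | y. True}
     \<and> diffeomorphic line_atlas4 {(Infty, y, Infty, neg1 y) | y. True}
         euclidean_atlas (sphere (0::complex) 1)"
proof (intro conjI)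
  note \<alpha>\<delta> = assms(4,5)
  \<comment> \<open>Finite x makes all coordinates finite. This yields real quadruples in the first
    claim and, by contraposition, infinite x in the second.\<close>
  have fin: "\<exists>a b c. y = Some a \<and> z = Some b \<and> w = Some c"
    if "(Some x, y, z, w) \<in> linkage_configs \<beta> \<beta> \<gamma> \<gamma>" for x y z w
    using deltoid_configs_finite[OF _ _ assms(3) that] assms(1,2) by auto
  have real: "(Some x, Some y, Some z, Some w) \<in> linkage_configs \<beta> \<beta> \<gamma> \<gamma> \<longleftrightarrow>
          x \<in> (if \<beta> > \<gamma>
               then {.. - sqrt (\<beta>\<^sup>2 / \<gamma>\<^sup>2 - 1)} \<union> {sqrt (\<beta>\<^sup>2 / \<gamma>\<^sup>2 - 1) ..}
               else UNIV) \<and>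
          (y = w \<and> w = (\<gamma> * x + sqrt (\<gamma>\<^sup>2 * (x\<^sup>2 + 1) - \<beta>\<^sup>2)) / (\<beta> - \<gamma>) \<and>
             z = - (sqrt (\<gamma>\<^sup>2 * (x\<^sup>2 + 1) - \<beta>\<^sup>2) / \<beta>) \<or>
           y = w \<and> w = (\<gamma> * x - sqrt (\<gamma>\<^sup>2 * (x\<^sup>2 + 1) - \<beta>\<^sup>2)) / (\<beta> - \<gamma>) \<and>
             z = sqrt (\<gamma>\<^sup>2 * (x\<^sup>2 + 1) - \<beta>\<^sup>2) / \<beta>)" for x y z w
  proof -
    define D where "D = \<gamma>\<^sup>2 * (x\<^sup>2 + 1) - \<beta>\<^sup>2"
    have "(\<beta> * z)\<^sup>2 = D \<longleftrightarrow> 0 \<le> D \<and> (\<beta> * z = - sqrt D \<or> \<beta> * z = sqrt D)"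
      by (metis power2_eq_iff real_sqrt_pow2 zero_le_power2)
    moreover have "\<beta> * z = - sqrt D \<longleftrightarrow> z = - (sqrt D / \<beta>)" "\<beta> * z = sqrt D \<longleftrightarrow> z = sqrt D / \<beta>"
      using assms(1) by (auto simp: field_simps)
    \<comment> \<open>The signs are opposite because z enters y = (\<gamma> x - \<beta> z) /
      (\<beta> - \<gamma>) negatively: the negative root for z gives the plus sign in y.\<close>
    ultimately show ?thesis
      unfolding deltoid_configs_real_iff[OF assms(1-3)] deltoid_domain_iff[OF assms(1,2)]
        D_def[symmetric]
      using assms(1) by auto
  qed
  show "{(x, y, z, w) \<in> linkage_configs \<alpha> \<beta> \<gamma> \<delta>. x \<noteq> Infty} =
       {(Some x, Some y, Some z, Some w) | x y z w :: real.
          x \<in> (if \<beta> > \<gamma>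
               then {.. - sqrt (\<beta>\<^sup>2 / \<gamma>\<^sup>2 - 1)} \<union> {sqrt (\<beta>\<^sup>2 / \<gamma>\<^sup>2 - 1) ..}
               else UNIV) \<and>
          (y = w \<and> w = (\<gamma> * x + sqrt (\<gamma>\<^sup>2 * (x\<^sup>2 + 1) - \<beta>\<^sup>2)) / (\<beta> - \<gamma>) \<and>
             z = - (sqrt (\<gamma>\<^sup>2 * (x\<^sup>2 + 1) - \<beta>\<^sup>2) / \<beta>) \<or>
           y = w \<and> w = (\<gamma> * x - sqrt (\<gamma>\<^sup>2 * (x\<^sup>2 + 1) - \<beta>\<^sup>2)) / (\<beta> - \<gamma>) \<and>
             z = sqrt (\<gamma>\<^sup>2 * (x\<^sup>2 + 1) - \<beta>\<^sup>2) / \<beta>)}"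
    unfolding real[symmetric] \<alpha>\<delta> using fin by (auto, metis)
  show "{(x, y, z, w) \<in> linkage_configs \<alpha> \<beta> \<gamma> \<delta>.
          x = Infty \<or> y = Infty \<or> z = Infty \<or> w = Infty} =
       {(Infty, y, Infty, neg1 y) | y. True}"
  proof (intro set_eqI iffI)
    fix p assume "p \<in> {(x, y, z, w) \<in> linkage_configs \<alpha> \<beta> \<gamma> \<delta>.
          x = Infty \<or> y = Infty \<or> z = Infty \<or> w = Infty}"
    then obtain x y z w where p: "p = (x, y, z, w)" "(x, y, z, w) \<in> linkage_configs \<beta> \<beta> \<gamma> \<gamma>"
      "x = Infty \<or> y = Infty \<or> z = Infty \<or> w = Infty"
      unfolding \<alpha>\<delta> by auto
    then have "x = None" using fin by (cases x) auto
    then show "p \<in> {(Infty, y, Infty, neg1 y) | y. True}"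
      using p assms(2) by (simp add: deltoid_configs_Infty_iff)
  next
    fix p assume "p \<in> {(Infty, y, Infty, neg1 y) | y. True}"
    then show "p \<in> {(x, y, z, w) \<in> linkage_configs \<alpha> \<beta> \<gamma> \<delta>.
          x = Infty \<or> y = Infty \<or> z = Infty \<or> w = Infty}"
      unfolding \<alpha>\<delta> using assms(2) by (auto simp: deltoid_configs_Infty_iff)
  qed
qed (rule branch_diffeomorphic_circle)

end
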